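(* For a positive integer $n$, let $\varrho(n)$ denote the number of ordered pairs $(j,k)$ of integers $j,k\ge 1$ with $\frac{jk(j+k)}{2}=n$. Then, as $x\to\infty$ (with $x$ real), $$\sum_{1\le n\le x}\varrho(n)=\frac{2^{2/3}\sqrt{3}\,\Gamma\left(\frac13\right)^3}{4\pi}\,x^{2/3}+2^{3/2}\,\zeta\left(\tfrac12\right)\sqrt{x}+O\left(x^{1/3}\right),$$ where the sum runs over integers $n$ with $1\le n\le x$.
   Context: Here $\Gamma$ is the Gamma function and $\zeta$ is the Riemann zeta function (so $\zeta(\tfrac12)$ is the value of its analytic continuation at $\tfrac12$). The $O$-constant is absolute. Interpretation (not needed for the statement): the irreducible representations of the Lie algebra $\mathfrak{su}(3)$ form a family $W_{j,k}$ with $\dim W_{j,k}=\frac{jk(j+k)}{2}$, $j,k\ge1$, so that $\varrho(n)$ is the number of irreducible $\mathfrak{su}(3)$-representations of dimension $n$. *)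

theory Defs
  imports "HOL-Complex_Analysis.Complex_Analysis" "HOL-Library.Landau_Symbols"
begin

text \<open>
  The Riemann zeta function as the analytic continuation of its Dirichlet series to the
  punctured plane. The identity theorem determines the value at every \<^term>\<open>s \<noteq> (1::complex)\<close>;
  the value at the pole is arbitrary.
\<close>
definition zeta :: "complex \<Rightarrow> complex" where
  "zeta = (SOME f. f holomorphic_on (- {1}) \<and>
             (\<forall>s. Re s > 1 \<longrightarrow> (\<lambda>n. 1 / of_nat (Suc n) powr s) sums f s))"

definition rho :: "nat \<Rightarrow> nat" where
  "rho n = card {(j :: nat, k :: nat). j \<ge> 1 \<and> k \<ge> 1 \<and> real (j * k * (j + k)) / 2 = real n}"

end

theory Submission imports Defs begin

text \<open>
  With \<open>a = x\<^sup>1\<^sup>/\<^sup>3\<close>, Dirichlet's hyperbola method writes the number of pairs with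
  \<open>j k (j + k) \<le> 2 x\<close> as \<open>2 \<Sum>\<^bsub>j \<le> a\<^esub> \<lfloor>K(j)\<rfloor> - \<lfloor>a\<rfloor>\<^sup>2\<close>, where \<open>k = K(j)\<close> is the positive root of
  \<open>j k (j + k) = 2 x\<close>. Dropping the floors costs \<open>O(a)\<close>, and \<open>K(j) = \<surd>(2 x / j) + a \<eta>(j / a) - j / 2\<close>
  with \<open>\<eta>\<close> increasing. The first term produces \<open>\<zeta>(1/2)\<close>; the second is a Riemann sum of a monotone
  function. All terms of order \<open>a\<^sup>2\<close> add up to the area of \<open>u v (u + v) \<le> 2\<close>, a Beta value.
  The continuation of \<open>\<zeta>\<close>, needed because \<open>\<zeta>\<close> is only specified as some continuation, comes from
  expanding \<open>(n + 1)\<^bsup>1 - s\<^esup>\<close> around \<open>n\<close> and summing over \<open>n\<close>.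
\<close>

subsection \<open>Analytic continuation of the zeta function\<close>

text \<open>The error at \<open>w = n + 2\<close> of the degree \<open>m\<close> Taylor polynomial
  of \<open>w powr (1 - s)\<close> at \<open>w = n + 1\<close>; with this shift a sum over all
  \<open>n\<close> starts at the base point 1.\<close>

definition zeta_taylor_remainder :: "nat \<Rightarrow> complex \<Rightarrow> nat \<Rightarrow> complex" where
  "zeta_taylor_remainder m s n = of_nat (Suc (Suc n)) powr (1 - s)
     - (\<Sum>k\<le>m. ((1 - s) gchoose k) * of_nat (Suc n) powr (1 - s - of_nat k))"

text \<open>The derivative of order \<open>m + 1\<close> has exponent \<open>- s - m\<close>, whose
  real part is at most 0 by hypothesis, so on the segment from \<open>n + 1\<close> to
  \<open>n + 2\<close> its norm is largest at the left end. The factor \<open>1 / fact m\<close> is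
  dropped.\<close>

lemma norm_zeta_taylor_remainder_le:
  assumes "Re s \<ge> - real m"
  shows "norm (zeta_taylor_remainder m s n)
           \<le> (\<Prod>i\<le>m. norm (1 - s - of_nat i)) * real (Suc n) powr (- Re s - real m)"
proof -
  define z where "z = 1 - s"
  \<comment> \<open>A convex set that avoids the branch cut of \<open>powr\<close>.\<close>
  define S :: "complex set" where "S = of_real ` {real (Suc n)..real (Suc (Suc n))}"
  \<comment> \<open>\<open>f i\<close> is the derivative of order \<open>i\<close> of
    \<open>w powr z\<close>.\<close>
  define f where "f i w = (\<Prod>l<i. z - of_nat l) * w powr (z - of_nat i)" for i w
  define B where "B = (\<Prod>i\<le>m. norm (1 - s - of_nat i)) * real (Suc n) powr (- Re s - real m)"
  have "convex S"
    unfolding S_def by (intro convex_linear_image) (auto intro: bounded_linear.linear bounded_linear_of_real)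
  have "cmod (f 0 (of_nat (Suc (Suc n))) - (\<Sum>i\<le>m. f i (of_nat (Suc n)) *
          (of_nat (Suc (Suc n)) - of_nat (Suc n)) ^ i / fact i))
        \<le> B * cmod (of_nat (Suc (Suc n)) - of_nat (Suc n)) ^ Suc m / fact m"
  proof (rule complex_Taylor[OF \<open>convex S\<close>])
    fix i x assume x: "x \<in> S"
    have "x \<notin> \<real>\<^sub>\<le>\<^sub>0" using x by (auto simp: S_def complex_nonpos_Reals_iff)
    then have "(f i has_field_derivative (\<Prod>l<i. z - of_nat l) *
                 ((z - of_nat i) * x powr (z - of_nat i - 1))) (at x)"
      unfolding f_def by (intro DERIV_cmult has_field_derivative_powr)
    also have "(\<Prod>l<i. z - of_nat l) * ((z - of_nat i) * x powr (z - of_nat i - 1)) = f (Suc i) x"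
      by (simp add: f_def algebra_simps)
    finally show "(f i has_field_derivative f (Suc i) x) (at x within S)"
      by (rule has_field_derivative_at_within)
  next
    fix x assume "x \<in> S"
    then obtain t where t: "x = of_real t" "real (Suc n) \<le> t" by (auto simp: S_def)
    have "norm (x powr (z - of_nat (Suc m))) = t powr (- Re s - real m)"
      using t by (subst norm_powr_real_powr) (auto simp: z_def)
    also have "\<dots> \<le> real (Suc n) powr (- Re s - real m)"
      using t assms by (intro powr_mono2') auto
    finally have "norm (x powr (z - of_nat (Suc m))) \<le> real (Suc n) powr (- Re s - real m)" .
    then show "norm (f (Suc m) x) \<le> B"
      unfolding f_def B_def norm_mult prod_norm [symmetric] z_def lessThan_Suc_atMost
      by (intro mult_left_mono prod_nonneg) auto
  next
    show "of_nat (Suc n) \<in> S" "of_nat (Suc (Suc n)) \<in> S"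
      unfolding S_def
      by (rule image_eqI[of _ _ "real (Suc n)"], simp, simp)
         (rule image_eqI[of _ _ "real (Suc (Suc n))"], simp, simp)
  qed
  also have "f 0 (of_nat (Suc (Suc n))) - (\<Sum>i\<le>m. f i (of_nat (Suc n)) *
          (of_nat (Suc (Suc n)) - of_nat (Suc n)) ^ i / fact i) = zeta_taylor_remainder m s n"
    unfolding zeta_taylor_remainder_def f_def z_def
    by (simp add: gbinomial_prod_rev atLeast0LessThan)
  also have "B * cmod (of_nat (Suc (Suc n)) - of_nat (Suc n)) ^ Suc m / fact m = B / fact m"
    by simp
  also have "\<dots> \<le> B"
  proof -
    have "B \<ge> 0" unfolding B_def by (intro mult_nonneg_nonneg prod_nonneg) auto
    then show ?thesis by (simp add: divide_le_eq mult_le_cancel_left1 not_less fact_ge_1)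
  qed
  finally show ?thesis unfolding B_def .
qed

text \<open>Near a point of this half-plane the exponent in the norm bound stays below -1 by a fixed
  margin, so the Weierstrass M-test gives locally uniform convergence of the holomorphic partial
  sums.\<close>

lemma holomorphic_on_zeta_taylor_remainder_suminf:
  "(\<lambda>s. \<Sum>n. zeta_taylor_remainder m s n) holomorphic_on {s. Re s > 1 - real m}"
  and summable_zeta_taylor_remainder:
  "Re s > 1 - real m \<Longrightarrow> summable (zeta_taylor_remainder m s)"
proof -
  have loc: "\<exists>d M. d > 0 \<and> cball s d \<subseteq> {s. Re s > 1 - real m} \<and> summable M \<and>
          (\<forall>n. \<forall>w\<in>cball s d. norm (zeta_taylor_remainder m w n) \<le> M n)"
    if s: "Re s > 1 - real m" for s
  proof -
    \<comment> \<open>Half the distance from \<open>s\<close> to the boundary line, so that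
      \<open>- Re w - m \<le> -1 - d\<close> on the whole closed ball.\<close>
    define d where "d = (Re s - (1 - real m)) / 2"
    define C where "C = (\<Prod>i\<le>m. norm (1 - s - of_nat i) + d)"
    define M where "M n = C * real (Suc n) powr (-1 - d)" for n
    have d: "d > 0" using s by (simp add: d_def)
    have re: "Re w \<ge> 1 - real m + d" if "w \<in> cball s d" for w
    proof -
      have "\<bar>Re (s - w)\<bar> \<le> d"
        using abs_Re_le_cmod[of "s - w"] that by (simp add: dist_norm)
      then have "Re w \<ge> Re s - d" by (simp add: abs_le_iff)
      also have "Re s - d = 1 - real m + d" by (simp add: d_def field_simps)
      finally show ?thesis by simp
    qed
    have "summable M"
      unfolding M_def using d
      by (intro summable_mult) (subst summable_Suc_iff, subst summable_real_powr_iff, simp)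
    moreover have "norm (zeta_taylor_remainder m w n) \<le> M n" if w: "w \<in> cball s d" for n w
    proof -
      have "norm (zeta_taylor_remainder m w n)
           \<le> (\<Prod>i\<le>m. norm (1 - w - of_nat i)) * real (Suc n) powr (- Re w - real m)"
        using re[OF w] d by (intro norm_zeta_taylor_remainder_le) auto
      also have "\<dots> \<le> C * real (Suc n) powr (-1 - d)"
        unfolding C_def
      proof (intro mult_mono prod_mono conjI powr_mono prod_nonneg)
        fix i
        have "norm (1 - w - of_nat i) \<le> norm (1 - s - of_nat i) + norm (s - w)"
          using norm_triangle_ineq[of "1 - s - of_nat i" "s - w"] by (simp add: algebra_simps)
        then show "norm (1 - w - of_nat i) \<le> norm (1 - s - of_nat i) + d"
          using w by (simp add: dist_norm)
      qed (use re[OF w] d in auto)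
      finally show ?thesis by (simp add: M_def)
    qed
    moreover have "cball s d \<subseteq> {s. Re s > 1 - real m}"
      using re d by force
    ultimately show ?thesis using d by blast
  qed
  show "summable (zeta_taylor_remainder m s)" if s: "Re s > 1 - real m" for s
  proof -
    obtain d M where "d > 0" "summable M"
      and le: "\<And>n w. w \<in> cball s d \<Longrightarrow> norm (zeta_taylor_remainder m w n) \<le> M n"
      using loc[OF s] by blast
    have "norm (zeta_taylor_remainder m s n) \<le> M n" for n
      using le[of s n] \<open>d > 0\<close> by simp
    with \<open>summable M\<close> show ?thesis by (rule summable_comparison_test'[of M 0])
  qed
  show "(\<lambda>s. \<Sum>n. zeta_taylor_remainder m s n) holomorphic_on {s. Re s > 1 - real m}"
  proof (rule holomorphic_uniform_sequence)
    show "open {s. Re s > 1 - real m}" by (rule open_halfspace_Re_gt)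
    show "(\<lambda>s. \<Sum>i<n. zeta_taylor_remainder m s i) holomorphic_on {s. Re s > 1 - real m}" for n
      unfolding zeta_taylor_remainder_def gbinomial_prod_rev
      by (intro holomorphic_intros) auto
    fix s assume "s \<in> {s. Re s > 1 - real m}"
    then obtain d M where d: "d > 0" "cball s d \<subseteq> {s. Re s > 1 - real m}"
      and M: "summable M"
      and le: "\<And>n w. w \<in> cball s d \<Longrightarrow> norm (zeta_taylor_remainder m w n) \<le> M n"
      using loc[of s] by blast
    have "uniform_limit (cball s d) (\<lambda>n s. \<Sum>i<n. zeta_taylor_remainder m s i)
         (\<lambda>s. \<Sum>n. zeta_taylor_remainder m s n) sequentially"
      using le M by (rule Weierstrass_m_test)
    with d show "\<exists>d>0. cball s d \<subseteq> {s. Re s > 1 - real m} \<and>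
      uniform_limit (cball s d) (\<lambda>n s. \<Sum>i<n. zeta_taylor_remainder m s i)
         (\<lambda>s. \<Sum>n. zeta_taylor_remainder m s n) sequentially"
      by blast
  qed
qed

section \<open>A recursion for the Dirichlet series and its continuation\<close>

definition zeta_series :: "complex \<Rightarrow> complex" where
  "zeta_series s = (\<Sum>n. 1 / of_nat (Suc n) powr s)"

lemma zeta_series_sums:
  assumes "Re s > 1"
  shows "(\<lambda>n. 1 / of_nat (Suc n) powr s) sums zeta_series s"
proof -
  have "summable (\<lambda>n. norm (of_nat (Suc n) powr (-s)))"
  proof -
    have "norm (of_nat (Suc n) powr (-s)) = real (Suc n) powr (- Re s)" for n
      by (subst norm_powr_real_powr) auto
    moreover have "summable (\<lambda>n. real (Suc n) powr (- Re s))"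
      using assms by (subst summable_Suc_iff, subst summable_real_powr_iff) simp
    ultimately show ?thesis by (simp only:)
  qed
  then have "summable (\<lambda>n. of_nat (Suc n) powr (-s))" by (rule summable_norm_cancel)
  then show ?thesis
    unfolding zeta_series_def by (intro summable_sums) (simp add: powr_minus_divide)
qed

text \<open>Summing the Taylor expansion of \<open>(n + 1)\<^bsup>1 - s\<^esup>\<close> at \<open>n\<close> over all \<open>n\<close> telescopes on the left.
  Multiplying the \<open>i\<close>-th zeta value by \<open>s + i - 1\<close> absorbs exactly the factor that distinguishes
  consecutive binomial coefficients, so the resulting recursion has no poles.\<close>
lemma zeta_series_recursion:
  assumes "Re s > 1"
  shows "(\<Sum>n. zeta_taylor_remainder m s n)
           = (\<Sum>i<m. ((1 - s) gchoose i) / of_nat (Suc i)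
                * ((s + of_nat i - 1) * zeta_series (s + of_nat i))) - 1"
proof -
  have lim: "(\<lambda>n. of_nat (Suc n) powr (1 - s)) \<longlonglongrightarrow> 0"
    using assms by (intro tendsto_neg_powr_complex_of_nat filterlim_Suc) auto
  have 1: "(\<lambda>n. of_nat (Suc (Suc n)) powr (1 - s) - of_nat (Suc n) powr (1 - s))
      sums (0 - of_nat (Suc 0) powr (1 - s))"
    using telescope_sums[OF lim] .
  have 2: "(\<lambda>n. \<Sum>i<m. ((1 - s) gchoose Suc i) * (1 / of_nat (Suc n) powr (s + of_nat i)))
          sums (\<Sum>i<m. ((1 - s) gchoose Suc i) * zeta_series (s + of_nat i))"
    using assms by (intro sums_sum sums_mult zeta_series_sums) auto
  have eq: "zeta_taylor_remainder m s n = (of_nat (Suc (Suc n)) powr (1 - s) - of_nat (Suc n) powr (1 - s))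
     - (\<Sum>i<m. ((1 - s) gchoose Suc i) * (1 / of_nat (Suc n) powr (s + of_nat i)))" for n
  proof -
    \<comment> \<open>The term \<open>k = 0\<close> joins the telescoping difference; the term
      \<open>k = i + 1\<close> is a term of the Dirichlet series at \<open>s + i\<close>.\<close>
    have "1 - s - of_nat (Suc i) = - (s + of_nat i)" for i by simp
    then show ?thesis
      unfolding zeta_taylor_remainder_def
      by (subst lessThan_Suc_atMost [symmetric], subst sum.lessThan_Suc_shift)
         (simp only: powr_minus_divide, simp)
  qed
  have gb: "((1 - s) gchoose Suc i) = - (((1 - s) gchoose i) / of_nat (Suc i) * (s + of_nat i - 1))" for i
    by (simp add: gbinomial_prod_rev field_simps del: of_nat_Suc) 
  have "zeta_taylor_remainder m s sums (0 - of_nat (Suc 0) powr (1 - s)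
      - (\<Sum>i<m. ((1 - s) gchoose Suc i) * zeta_series (s + of_nat i)))"
    using sums_diff[OF 1 2] by (simp only: eq [abs_def])
  then have "(\<Sum>n. zeta_taylor_remainder m s n) = 0 - of_nat (Suc 0) powr (1 - s)
      - (\<Sum>i<m. ((1 - s) gchoose Suc i) * zeta_series (s + of_nat i))"
    by (rule sums_unique [symmetric])
  also have "\<dots> = (\<Sum>i<m. ((1 - s) gchoose i) / of_nat (Suc i)
                * ((s + of_nat i - 1) * zeta_series (s + of_nat i))) - 1"
    unfolding gb
    by (simp only: sum_negf mult.assoc mult_minus_left of_nat_1 One_nat_def[symmetric] powr_one_eq_one) simp
  finally show ?thesis .
qed

text \<open>Working with \<open>(s - 1) * zeta_series s\<close> removes the pole. Each induction
  step gains a strip of width 1: the recursion expresses its own \<open>i = 0\<close> term through a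
  remainder series, holomorphic on the larger half-plane, and through values at \<open>s + i\<close>
  with \<open>i \<ge> 1\<close>, where the previous \<open>F\<close> is available.\<close>

lemma zeta_continuation_halfplane:
  "\<exists>F. F holomorphic_on {s. Re s > - real m} \<and> (\<forall>s. Re s > 1 \<longrightarrow> F s = (s - 1) * zeta_series s)"
proof (induction m)
  case 0
  define F where "F s = 1 + (\<Sum>n. zeta_taylor_remainder 1 s n)" for s
  have "F holomorphic_on {s. Re s > - real 0}"
    unfolding F_def using holomorphic_on_zeta_taylor_remainder_suminf[of 1]
    by (intro holomorphic_intros) auto
  moreover have "F s = (s - 1) * zeta_series s" if "Re s > 1" for s
    unfolding F_def using zeta_series_recursion[OF that, of 1] by simp
  ultimately show ?case by blast
next
  case (Suc m)
  then obtain F where F: "F holomorphic_on {s. Re s > - real m}"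
    "\<And>s. Re s > 1 \<Longrightarrow> F s = (s - 1) * zeta_series s" by blast
  \<comment> \<open>The recursion of order \<open>m + 2\<close>, solved for its term
    \<open>i = 0\<close>, which has coefficient 1.\<close>
  define G where "G s = 1 + (\<Sum>n. zeta_taylor_remainder (Suc (Suc m)) s n)
     - (\<Sum>i<Suc m. ((1 - s) gchoose Suc i) / of_nat (Suc (Suc i)) * F (s + of_nat (Suc i)))" for s
  have "(\<lambda>s. F (s + of_nat (Suc i))) holomorphic_on {s. Re s > - real (Suc m)}" for i
  proof -
    have "(F \<circ> (\<lambda>s. s + of_nat (Suc i))) holomorphic_on {s. Re s > - real (Suc m)}"
      by (rule holomorphic_on_compose_gen[OF _ F(1)]) (auto intro!: holomorphic_intros)
    then show ?thesis by (simp add: o_def)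
  qed
  moreover have "(\<lambda>s. \<Sum>n. zeta_taylor_remainder (Suc (Suc m)) s n) holomorphic_on {s. Re s > - real (Suc m)}"
    using holomorphic_on_zeta_taylor_remainder_suminf[of "Suc (Suc m)"] by simp
  ultimately have "G holomorphic_on {s. Re s > - real (Suc m)}"
    unfolding G_def gbinomial_prod_rev by (intro holomorphic_intros) (auto simp del: of_nat_Suc)
  moreover have "G s = (s - 1) * zeta_series s" if "Re s > 1" for s
    unfolding G_def using that
    by (subst zeta_series_recursion[OF that], subst sum.lessThan_Suc_shift) (simp add: F(2) algebra_simps)
  ultimately show ?case by blast
qed

text \<open>By the identity theorem the continuations to the half-planes agree where they overlap.
  They glue to an entire function, which is then divided by \<open>s - 1\<close>.\<close>

lemma zeta_continuation_exists:
  "\<exists>f. f holomorphic_on (- {1}) \<and>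
     (\<forall>s. Re s > 1 \<longrightarrow> (\<lambda>n. 1 / of_nat (Suc n) powr s) sums f s)"
proof -
  obtain F where hol: "\<And>m. F m holomorphic_on {s. Re s > - real m}"
    and F: "\<And>m s. Re s > 1 \<Longrightarrow> F m s = (s - 1) * zeta_series s"
    using zeta_continuation_halfplane by metis
  have agree: "F m s = F n s" if "Re s > - real m" "m \<le> n" for m n s
  proof (rule analytic_continuation_open[of "{s. Re s > 1}" "{s. Re s > - real m}" "F m" "F n"])
    show "{s. Re s > 1} \<noteq> {}" by (auto intro: exI[of _ "2::complex"])
    show "F n holomorphic_on {s. Re s > - real m}"
      using that by (intro holomorphic_on_subset[OF hol]) auto
    show "connected {s. Re s > - real m}"
      by (intro convex_connected convex_halfspace_Re_gt)
  qed (use that F hol in \<open>auto simp: open_halfspace_Re_gt\<close>)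
  \<comment> \<open>The index is an integer larger than \<open>- Re s\<close>, so \<open>s\<close>
    lies in the half-plane on which that \<open>F\<close> is holomorphic.\<close>
  define G where "G s = F (nat \<lceil>\<bar>Re s\<bar>\<rceil> + 1) s" for s
  have G: "G s = F m s" if "Re s > - real m" for m s
  proof -
    have "Re s > - real (nat \<lceil>\<bar>Re s\<bar>\<rceil> + 1)" by linarith
    then show ?thesis unfolding G_def using agree that by (metis nat_le_linear)
  qed
  have "G holomorphic_on UNIV"
  proof -
    have "G holomorphic_on (\<Union>m. {s. Re s > - real m})"
    proof (rule holomorphic_on_UN_open)
      show "G holomorphic_on {s. Re s > - real m}" for m
        using hol[of m] by (rule holomorphic_transform) (simp add: G)
    qed (auto simp: open_halfspace_Re_gt)
    also have "(\<Union>m. {s. Re s > - real m}) = UNIV"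
    proof safe
      fix s show "s \<in> (\<Union>m. {s. Re s > - real m})"
        by (rule UN_I[of "nat \<lceil>\<bar>Re s\<bar>\<rceil> + 1"]) (auto, linarith)
    qed auto
    finally show ?thesis .
  qed
  then have "(\<lambda>s. G s / (s - 1)) holomorphic_on - {1}"
    by (intro holomorphic_intros) (auto elim: holomorphic_on_subset)
  moreover have "G s / (s - 1) = zeta_series s" if "Re s > 1" for s
  proof -
    have "s \<noteq> 1" using that by auto
    then show ?thesis using G[of 0 s] F[of s 0] that by simp
  qed
  ultimately show ?thesis
    by (intro exI[of _ "\<lambda>s. G s / (s - 1)"]) (simp add: zeta_series_sums del: of_nat_Suc)
qed

text \<open>Existence makes the choice in \<open>zeta\<close> a genuine continuation. Everything
  later about \<open>zeta\<close> rests on these two properties.\<close>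

lemma holomorphic_on_zeta: "zeta holomorphic_on (- {1})"
  and zeta_sums: "Re s > 1 \<Longrightarrow> (\<lambda>n. 1 / of_nat (Suc n) powr s) sums zeta s"
  using someI_ex[OF zeta_continuation_exists] unfolding zeta_def by blast+

text \<open>The recursion with \<open>m = 1\<close> gives this for \<open>Re s > 1\<close>. Both
  sides are holomorphic on the punctured half-plane, which is connected, so the identity extends far
  enough to reach \<open>s = 1/2\<close>.\<close>

lemma zeta_eq_taylor_remainder:
  assumes "Re s > 0" "s \<noteq> 1"
  shows "(s - 1) * zeta s = 1 + (\<Sum>n. zeta_taylor_remainder 1 s n)"
proof (rule analytic_continuation_open[of "{s. Re s > 1}" "{s. Re s > 0} - {1}"
      "\<lambda>s. (s - 1) * zeta s" "\<lambda>s. 1 + (\<Sum>n. zeta_taylor_remainder 1 s n)"])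
  show "{s. Re s > 1} \<noteq> {}" by (auto intro: exI[of _ "2::complex"])
  show "connected ({s. Re s > 0} - {1::complex})"
    by (intro connected_open_delete convex_connected convex_halfspace_Re_gt open_halfspace_Re_gt) auto
  show "(\<lambda>s. (s - 1) * zeta s) holomorphic_on {s. Re s > 0} - {1}"
    by (intro holomorphic_intros holomorphic_on_subset[OF holomorphic_on_zeta]) auto
  show "(\<lambda>s. 1 + (\<Sum>n. zeta_taylor_remainder 1 s n)) holomorphic_on {s. Re s > 0} - {1}"
    using holomorphic_on_zeta_taylor_remainder_suminf[of 1]
    by (intro holomorphic_intros) (auto elim: holomorphic_on_subset)
  fix s :: complex assume "s \<in> {s. Re s > 1}"
  then have s: "Re s > 1" by simp
  have "zeta s = zeta_series s"
    using zeta_sums[OF s] zeta_series_sums[OF s] by (rule sums_unique2)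
  then show "(s - 1) * zeta s = 1 + (\<Sum>n. zeta_taylor_remainder 1 s n)"
    using zeta_series_recursion[OF s, of 1] by simp
qed (use assms in \<open>auto simp: open_halfspace_Re_gt open_Diff\<close>)

section \<open>Partial sums of inverse square roots and the value at 1/2\<close>

text \<open>At \<open>s = 1/2\<close> the remainder is
  \<open>sqrt (n + 2) - sqrt (n + 1) - 1 / (2 * sqrt (n + 1))\<close>, which is -1/2 times an
  increment of the sequence in question, so the remainder series telescopes.\<close>

lemma sum_inverse_sqrt_tendsto_zeta_half:
  "(\<lambda>N. complex_of_real ((\<Sum>n=1..N. 1 / sqrt (real n)) - 2 * sqrt (Suc N))) \<longlonglongrightarrow> zeta (1/2)"
proof -
  define D where "D N = (\<Sum>n=1..N. 1 / sqrt (real n)) - 2 * sqrt (Suc N)" for N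
  have rem: "zeta_taylor_remainder 1 (1/2) n = of_real (- (D (Suc n) - D n) / 2)" for n
  proof -
    have a: "complex_of_nat (Suc k) powr (1/2) = of_real (sqrt (Suc k))" for k
    proof -
      have "complex_of_real (real (Suc k)) powr of_real (1/2) = of_real (real (Suc k) powr (1/2))"
        by (rule powr_of_real) auto
      then show ?thesis by (simp add: powr_half_sqrt del: of_nat_Suc)
    qed
    have b: "complex_of_nat (Suc k) powr (-1/2) = of_real (1 / sqrt (Suc k))" for k
      using a[of k] by (simp only: minus_divide_left [symmetric] powr_minus_divide of_real_divide of_real_1)
    have one: "complex_of_nat (Suc 0) = 1" by simp
    have e: "(1 - 1 / 2 - 1 :: complex) = -1 / 2" by simp
    have "zeta_taylor_remainder 1 (1/2) n = of_nat (Suc (Suc n)) powr (1/2)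
            - (of_nat (Suc n) powr (1/2) + 1 / 2 * of_nat (Suc n) powr (-1/2))"
      unfolding zeta_taylor_remainder_def One_nat_def atMost_Suc
      by (simp del: of_nat_Suc add: one e)
    then show ?thesis
      unfolding D_def a b by (simp del: of_nat_Suc add: diff_divide_distrib add_divide_distrib)
  qed
  have "(\<lambda>N. \<Sum>n<N. zeta_taylor_remainder 1 (1/2) n) \<longlonglongrightarrow> (\<Sum>n. zeta_taylor_remainder 1 (1/2) n)"
    by (intro summable_LIMSEQ summable_zeta_taylor_remainder) auto
  also have "(\<lambda>N. \<Sum>n<N. zeta_taylor_remainder 1 (1/2) n) = (\<lambda>N. of_real (- (D N - D 0) / 2))"
  proof
    fix N
    have "(\<Sum>n<N. zeta_taylor_remainder 1 (1/2) n) = of_real (\<Sum>n<N. - (D (Suc n) - D n) / 2)"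
      unfolding rem by simp
    also have "(\<Sum>n<N. - (D (Suc n) - D n) / 2) = - (D N - D 0) / 2"
      by (induction N) (simp_all add: diff_divide_distrib)
    finally show "(\<Sum>n<N. zeta_taylor_remainder 1 (1/2) n) = of_real (- (D N - D 0) / 2)" .
  qed
  finally have "(\<lambda>N. -2 * of_real (- (D N - D 0) / 2) + of_real (D 0)) \<longlonglongrightarrow>
                  -2 * (\<Sum>n. zeta_taylor_remainder 1 (1/2) n) + of_real (D 0)"
    by (intro tendsto_intros)
  also have "(\<lambda>N. -2 * of_real (- (D N - D 0) / 2) + of_real (D 0)) = (\<lambda>N. complex_of_real (D N))"
    by (simp add: field_simps)
  also have "-2 * (\<Sum>n. zeta_taylor_remainder 1 (1/2) n) + of_real (D 0) = zeta (1/2)"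
  proof -
    \<comment> \<open>The factor -2 inverts \<open>s - 1 = -1/2\<close>, and the constant term -2 on
      the right is exactly \<open>D 0\<close>.\<close>
    have "-2 * ((1 / 2 - 1) * zeta (1/2)) = -2 * (1 + (\<Sum>n. zeta_taylor_remainder 1 (1/2) n))"
      by (subst zeta_eq_taylor_remainder) auto
    then show ?thesis by (simp add: D_def)
  qed
  finally show ?thesis by (simp add: D_def)
qed

text \<open>The sequence increases to its limit while the sequence plus
  \<open>1 / sqrt (N + 1)\<close> decreases to the same limit, so the gap is at most that term. As
  the sequence is real, so is \<open>zeta (1/2)\<close>.\<close>

lemma sum_inverse_sqrt_bounds:
  obtains z :: real where "zeta (1/2) = complex_of_real z"
    "\<And>N. \<bar>(\<Sum>n=1..N. 1 / sqrt (real n)) - 2 * sqrt (Suc N) - z\<bar> \<le> 1 / sqrt (Suc N)"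
proof -
  define D where "D N = (\<Sum>n=1..N. 1 / sqrt (real n)) - 2 * sqrt (Suc N)" for N
  have lim: "(\<lambda>N. complex_of_real (D N)) \<longlonglongrightarrow> zeta (1/2)"
    unfolding D_def by (rule sum_inverse_sqrt_tendsto_zeta_half)
  define z where "z = Re (zeta (1/2))"
  have z: "D \<longlonglongrightarrow> z" using tendsto_Re[OF lim] by (simp add: z_def)
  have "zeta (1/2) = complex_of_real z"
    by (rule LIMSEQ_unique[OF lim tendsto_of_real[OF z]])
  have step: "D N \<le> D (Suc N) \<and> D (Suc N) + 1 / sqrt (Suc (Suc N)) \<le> D N + 1 / sqrt (Suc N)" for N
  proof -
    define p q where "p = sqrt (Suc N)" and "q = sqrt (Suc (Suc N))"
    have pq: "p > 0" "q > 0" "p \<le> q" "q^2 - p^2 = 1" by (simp_all add: p_def q_def)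
    have d: "D (Suc N) = D N + 1 / p - 2 * (q - p)" by (simp add: D_def p_def q_def)
    \<comment> \<open>Rationalising puts \<open>2 * (q - p)\<close> between \<open>1 / q\<close> and
      \<open>1 / p\<close>; these are the two monotonicity claims.\<close>
    have e: "q - p = 1 / (q + p)" using pq by (simp add: field_simps power2_eq_square)
    have "1 / (q + p) \<le> 1 / (2 * p)" "1 / (2 * q) \<le> 1 / (q + p)"
      using pq by (auto intro!: divide_left_mono mult_pos_pos)
    then have "2 * (q - p) \<le> 1 / p" "1 / q \<le> 2 * (q - p)" unfolding e by auto
    then show ?thesis using d by (simp add: p_def q_def)
  qed
  have "\<bar>D N - z\<bar> \<le> 1 / sqrt (Suc N)" for N
  proof -
    have "incseq D" using step by (intro incseq_SucI) blast
    then have "D N \<le> z" using z by (rule incseq_le)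
    moreover have "decseq (\<lambda>N. D N + 1 / sqrt (Suc N))"
      using step by (intro decseq_SucI) blast
    moreover have "(\<lambda>N. D N + 1 / sqrt (Suc N)) \<longlonglongrightarrow> z + 0"
    proof (intro tendsto_add z)
      show "(\<lambda>N. 1 / sqrt (Suc N)) \<longlonglongrightarrow> 0"
        using LIMSEQ_inverse_real_of_nat tendsto_real_sqrt[of "\<lambda>n. inverse (real (Suc n))" 0]
        by (simp add: real_sqrt_inverse inverse_eq_divide real_sqrt_divide)
    qed
    ultimately have "z \<le> D N + 1 / sqrt (Suc N)"
      using decseq_ge[of "\<lambda>N. D N + 1 / sqrt (Suc N)" z N] by simp
    with \<open>D N \<le> z\<close> show ?thesis by linarith
  qed
  then show ?thesis using that[OF \<open>zeta (1/2) = complex_of_real z\<close>] by (simp add: D_def)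
qed

subsection \<open>The area constant\<close>

text \<open>The rationalised form of \<open>sqrt (2 / s + s^2 / 4) - sqrt (2 / s)\<close>, which
  extends continuously to \<open>s = 0\<close>. The curve \<open>u * v * (u + v) = 2\<close> is
  \<open>v = sqrt (2 / u) + eta u - u / 2\<close>.\<close>

definition eta :: "real \<Rightarrow> real" where
  "eta s = s\<^sup>2 * sqrt s / (2 * (sqrt (8 + s ^ 3) + sqrt 8))"

lemma eta_eq:
  assumes "s > 0"
  shows "eta s = sqrt (2 / s + s\<^sup>2 / 4) - sqrt (2 / s)"
proof -
  define r A B where "r = sqrt s" and "A = sqrt (8 + s ^ 3)" and "B = sqrt 8"
  have r: "r > 0" "s = r\<^sup>2" using assms by (simp_all add: r_def)
  have AB: "A > 0" "B > 0" "A\<^sup>2 - B\<^sup>2 = s ^ 3"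
    using assms by (simp_all add: A_def B_def add_pos_pos)
  have "sqrt (2 / s + s\<^sup>2 / 4) = A / (2 * r)"
  proof (rule real_sqrt_unique)
    show "(A / (2 * r))\<^sup>2 = 2 / s + s\<^sup>2 / 4"
      using assms r unfolding A_def by (simp add: power_divide power_mult_distrib field_simps eval_nat_numeral)
  qed (use AB r in auto)
  moreover have "sqrt (2 / s) = B / (2 * r)"
  proof (rule real_sqrt_unique)
    show "(B / (2 * r))\<^sup>2 = 2 / s"
      using assms r unfolding B_def by (simp add: power_divide power_mult_distrib field_simps)
  qed (use AB r in auto)
  moreover have "A - B = s ^ 3 / (A + B)"
  proof -
    have "(A - B) * (A + B) = s ^ 3" using AB by (simp add: algebra_simps power2_eq_square)
    then show ?thesis using AB by (simp add: field_simps)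
  qed
  moreover have "s ^ 3 / (A + B) / (2 * r) = s\<^sup>2 * r / (2 * (A + B))"
  proof -
    have "r ^ 6 / T / (2 * r) = r ^ 4 * r / (2 * T)" if "T > 0" for T
      using that r(1) by (simp add: field_simps eval_nat_numeral)
    from this[of "A + B"] show ?thesis using AB by (simp add: r(2) flip: power_mult)
  qed
  moreover have "eta s = s\<^sup>2 * r / (2 * (A + B))" by (simp only: eta_def r_def A_def B_def)
  ultimately show ?thesis by (simp only: diff_divide_distrib [symmetric])
qed

lemma eta_eq_quotient:
  assumes "s > 0"
  shows "eta s = (s\<^sup>2 / 4) / (sqrt (2 / s + s\<^sup>2 / 4) + sqrt (2 / s))"
proof -
  define A B where "A = sqrt (2 / s + s\<^sup>2 / 4)" and "B = sqrt (2 / s)"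
  have AB: "A > 0" "B > 0" "A\<^sup>2 - B\<^sup>2 = s\<^sup>2 / 4"
    using assms by (simp_all add: A_def B_def add_pos_pos)
  have "(A - B) * (A + B) = s\<^sup>2 / 4" using AB by (simp add: algebra_simps power2_eq_square)
  then have "A - B = s\<^sup>2 / 4 / (A + B)" using AB by (simp add: field_simps)
  then show ?thesis using eta_eq[OF assms] by (simp add: A_def B_def)
qed

lemma eta_nonneg: "s \<ge> 0 \<Longrightarrow> eta s \<ge> 0"
  by (simp add: eta_def)

lemma eta_mono: "mono_on {0..1} eta"
proof (rule mono_onI)
  fix s t :: real assume "s \<in> {0..1}" "t \<in> {0..1}" "s \<le> t"
  then have st: "0 \<le> s" "s \<le> t" "t \<le> 1" by auto
  show "eta s \<le> eta t"
  proof (cases "s = 0")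
    case True
    then show ?thesis using eta_nonneg[of t] st by (simp add: eta_def)
  next
    case False
    then have s: "s > 0" "t > 0" using st by auto
    \<comment> \<open>Hence \<open>2 / (s * t)\<close> is at least 2 while
      \<open>(t + s) / 4\<close> is at most 1/2: the drop in \<open>2 / s\<close> outweighs the
      growth of \<open>s^2 / 4\<close>.\<close>
    have "s * t \<le> 1 * 1" using st by (intro mult_mono) auto
    then have "1 \<le> 1 / (s * t)" using s by simp
    then have "(t - s) * (2 / (s * t)) \<ge> (t - s) * ((t + s) / 4)"
      using st by (intro mult_left_mono) (auto simp: field_simps)
    moreover have "(t - s) * (2 / (s * t)) = 2 / s - 2 / t" using s by (simp add: field_simps)
    moreover have "(t - s) * ((t + s) / 4) = t\<^sup>2 / 4 - s\<^sup>2 / 4" by (simp add: field_simps power2_eq_square)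
    ultimately have "2 / t + t\<^sup>2 / 4 \<le> 2 / s + s\<^sup>2 / 4" by linarith
    moreover have "2 / t \<le> 2 / s" using s st by (intro divide_left_mono) auto
    ultimately have "sqrt (2 / t + t\<^sup>2 / 4) + sqrt (2 / t) \<le> sqrt (2 / s + s\<^sup>2 / 4) + sqrt (2 / s)"
      by (intro add_mono) auto
    moreover have "s\<^sup>2 / 4 \<le> t\<^sup>2 / 4" using st by (simp add: power_mono)
    ultimately show ?thesis
      unfolding eta_eq_quotient[OF s(1)] eta_eq_quotient[OF s(2)]
      using s by (intro frac_le) (auto intro!: add_nonneg_pos)
  qed
qed

lemma continuous_on_eta: "continuous_on {0..b} eta"
proof -
  have "2 * (sqrt (8 + s ^ 3) + sqrt 8) \<noteq> 0" if "s \<in> {0..b}" for s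
    using that by (intro less_imp_neq[symmetric] mult_pos_pos add_nonneg_pos) auto
  then show ?thesis
    unfolding eta_def by (intro continuous_intros ballI)
qed

section \<open>Riemann sums of monotone functions\<close>

text \<open>On each cell of width \<open>1 / a\<close> the function lies between its endpoint
  values, so left endpoints (from \<open>j = 0\<close>) bound the integral below and right endpoints
  (from \<open>j = 1\<close>) above.\<close>

lemma riemann_sum_mono_bounds:
  fixes f :: "real \<Rightarrow> real"
  assumes mono: "mono_on {0..1} f" and cont: "continuous_on {0..1} f"
    and a: "a > 0" and N: "real N \<le> a"
  shows "(\<Sum>j<N. f (real j / a)) \<le> a * integral {0..N / a} f"
    and "a * integral {0..N / a} f \<le> (\<Sum>j=1..N. f (real j / a))"
proof -
  have "(\<Sum>j<N. f (real j / a)) \<le> a * integral {0..N / a} f \<and>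
        a * integral {0..N / a} f \<le> (\<Sum>j=1..N. f (real j / a))"
    using N
  proof (induction N)
    case (Suc N)
    let ?l = "N / a" and ?u = "Suc N / a"
    have lu: "0 \<le> ?l" "?l \<le> ?u" "?u \<le> 1" "?u - ?l = 1 / a"
      using Suc.prems a by (auto simp: divide_right_mono diff_divide_distrib [symmetric])
    have int: "f integrable_on {0..?u}" "f integrable_on {?l..?u}"
      using lu by (auto intro!: integrable_continuous_real continuous_on_subset[OF cont])
    have split: "integral {0..?u} f = integral {0..?l} f + integral {?l..?u} f"
      using Henstock_Kurzweil_Integration.integral_combine[OF lu(1,2) int(1)] by simp
    have "integral {?l..?u} (\<lambda>_. f ?l) \<le> integral {?l..?u} f"
      using lu int by (intro integral_le integrable_const_ivl mono_onD[OF mono]) auto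
    moreover have "integral {?l..?u} f \<le> integral {?l..?u} (\<lambda>_. f ?u)"
      using lu int by (intro integral_le integrable_const_ivl mono_onD[OF mono]) auto
    ultimately have "f ?l \<le> a * integral {?l..?u} f" "a * integral {?l..?u} f \<le> f ?u"
      using lu a by (simp_all add: field_simps)
    then show ?case
      using Suc by (simp add: split distrib_left del: of_nat_Suc)
  qed simp
  then show "(\<Sum>j<N. f (real j / a)) \<le> a * integral {0..N / a} f"
    and "a * integral {0..N / a} f \<le> (\<Sum>j=1..N. f (real j / a))" by auto
qed

text \<open>Two errors of opposite sign, each at most \<open>f 1\<close>: the right sum exceeds the
  integral up to \<open>M / a\<close> by at most its excess over the left sum, and the integral over
  the rest of the interval, of length at most \<open>1 / a\<close>, is missing from the sum.\<close>

lemma riemann_sum_mono_error: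
  fixes f :: "real \<Rightarrow> real"
  assumes mono: "mono_on {0..1} f" and cont: "continuous_on {0..1} f"
    and f0: "f 0 \<ge> 0" and a: "a \<ge> 1"
  shows "\<bar>(\<Sum>j=1..nat \<lfloor>a\<rfloor>. f (real j / a)) - a * integral {0..1} f\<bar> \<le> f 1"
proof -
  define M where "M = nat \<lfloor>a\<rfloor>"
  have M: "real M \<le> a" "a < real M + 1" "M \<ge> 1" using a unfolding M_def by linarith+
  let ?l = "M / a"
  have "1 - ?l = (a - M) / a" using a by (simp add: field_simps)
  also have "\<dots> \<le> 1 / a" using M a by (intro divide_right_mono) auto
  finally have l: "0 \<le> ?l" "?l \<le> 1" "1 - ?l \<le> 1 / a" using M a by auto
  have nonneg: "f t \<ge> 0" if "t \<in> {0..1}" for t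
    using mono_onD[OF mono, of 0 t] that f0 by auto
  have int: "f integrable_on {0..1}" "f integrable_on {?l..1}"
    using l by (auto intro!: integrable_continuous_real continuous_on_subset[OF cont])
  have split: "integral {0..1} f = integral {0..?l} f + integral {?l..1} f"
    using Henstock_Kurzweil_Integration.integral_combine[OF l(1,2) int(1)] by simp
  have i0: "0 \<le> integral {?l..1} f"
    using l int nonneg by (intro integral_nonneg) auto
  have "integral {?l..1} f \<le> integral {?l..1} (\<lambda>_. f 1)"
    using l int by (intro integral_le integrable_const_ivl mono_onD[OF mono]) auto
  also have "\<dots> = (1 - ?l) * f 1" using l by simp
  also have "\<dots> \<le> 1 / a * f 1" using l nonneg by (intro mult_right_mono) auto
  finally have i1: "a * integral {?l..1} f \<le> f 1" using a by (simp add: field_simps)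
  have "a > 0" using a by simp
  note b = riemann_sum_mono_bounds[OF mono cont \<open>a > 0\<close> M(1)]
  have "(\<Sum>j=1..M. f (real j / a)) = (\<Sum>j<Suc M. f (real j / a)) - f 0"
    by (simp add: sum.atLeast1_atMost_eq sum.lessThan_Suc_shift del: sum.lessThan_Suc)
  then have "(\<Sum>j=1..M. f (real j / a)) \<le> (\<Sum>j<M. f (real j / a)) + f 1"
    using mono_onD[OF mono, of ?l 1] l f0 by simp
  moreover have "0 \<le> a * integral {?l..1} f" using i0 a by simp
  ultimately show ?thesis
    using b i1 unfolding M_def [symmetric] split by (simp add: distrib_left abs_le_iff)
qed

section \<open>The area as a Beta value\<close>

text \<open>The reflection formula at 1/3 eliminates \<open>Gamma (2/3)\<close> from
  \<open>Gamma (1/3) ^ 2 / Gamma (2/3)\<close>.\<close>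

lemma Beta_third: "Beta (1/3) (1/3 :: real) = sqrt 3 * Gamma (1/3) ^ 3 / (2 * pi)"
proof -
  have "complex_of_real (Gamma (1/3) * Gamma (2/3)) = Gamma (of_real (1/3)) * Gamma (1 - of_real (1/3))"
    by (simp flip: Gamma_complex_of_real)
  also have "\<dots> = of_real pi / sin (of_real (pi * (1/3)))"
    by (subst Gamma_reflection_complex) simp
  also have "\<dots> = of_real (pi / sin (pi / 3))"
    by (simp only: sin_of_real of_real_divide) simp
  also have "pi / sin (pi / 3) = 2 * pi / sqrt 3" by (simp add: sin_60)
  finally have "complex_of_real (Gamma (1/3) * Gamma (2/3)) = of_real (2 * pi / sqrt 3)" .
  then have "Gamma (1/3) * Gamma (2/3) = 2 * pi / sqrt (3::real)"
    by (simp only: of_real_eq_iff)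
  then have "2 * pi = sqrt 3 * (Gamma (1/3) * Gamma (2/3 :: real))" by (simp add: field_simps)
  moreover have "Gamma (1/3 :: real) > 0" "Gamma (2/3 :: real) > 0" by (simp_all add: Gamma_real_pos)
  moreover have "Beta (1/3) (1/3 :: real) = Gamma (1/3) ^ 2 / Gamma (2/3)"
    by (simp add: Beta_def power2_eq_square)
  ultimately show ?thesis by (simp add: field_simps eval_nat_numeral)
qed

text \<open>The area under the curve \<open>u v (u + v) = 2\<close>, parametrised by \<open>p = u / (u + v)\<close>: along the curve
  \<open>v du - u dv = (u + v)\<^sup>2 dp\<close>, which is a Beta integrand.\<close>
lemma area_constant:
  "4 * sqrt 2 + 2 * integral {0..1} eta - 3 / 2 = 2 powr (2/3) * sqrt 3 * Gamma (1/3) ^ 3 / (4 * pi)"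
proof -
  \<comment> \<open>The scale for which the parametrised point satisfies
    \<open>u * v * (u + v) = c ^ 3 = 2\<close>.\<close>
  define c :: real where "c = 2 powr (1/3)"
  have c: "c > 0" "c ^ 3 = 2" "c\<^sup>2 = 2 powr (2/3)"
    by (simp_all add: c_def powr_power)
  \<comment> \<open>The area under the curve over \<open>{0..t}\<close>: an antiderivative of
    \<open>sqrt (2 / u) + eta u - u / 2\<close>.\<close>
  define \<Phi> where "\<Phi> t = 2 * sqrt 2 * sqrt t + integral {0..t} eta - t\<^sup>2 / 4" for t
  define u where "u p = c * (p powr (2/3) * (1 - p) powr (-1/3))" for p
  define uv where "uv p = c\<^sup>2 * (p powr (1/3) * (1 - p) powr (1/3))" for p
  \<comment> \<open>Its differential is \<open>2 * v du - d(u v) = v du - u dv\<close>.\<close>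
  define H where "H p = 2 * \<Phi> (u p) - uv p" for p
  define f :: "real \<Rightarrow> real" where "f p = p powr (-2/3) * (1 - p) powr (-2/3)" for p
  \<comment> \<open>The range \<open>p \<le> 1/2\<close> is the half of the curve with
    \<open>u \<le> v\<close>, ending at \<open>u = v = 1\<close>; it keeps \<open>u\<close> where
    \<open>eta\<close> is integrated.\<close>
  have u1: "0 \<le> u p \<and> u p \<le> 1" if "p \<in> {0..1/2}" for p
  proof -
    have "u p ^ 3 = 2 * p\<^sup>2 / (1 - p)"
      using that c
      by (cases "p = 0") (simp_all add: u_def power_mult_distrib power_divide powr_power powr_minus_divide)
    also have "\<dots> \<le> 1"
    proof -
      have "(1 - 2 * p) * (1 + p) \<ge> 0" using that by (intro mult_nonneg_nonneg) auto
      then show ?thesis using that by (simp add: field_simps power2_eq_square)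
    qed
    finally have "u p ^ 3 \<le> 1 ^ 3" by simp
    moreover have "u p \<ge> 0" using c by (simp add: u_def)
    ultimately show ?thesis using power_mono_iff[of "u p" 1 3] by simp
  qed
  \<comment> \<open>Integrating up to 2 gives a two-sided derivative also at
    \<open>t = 1\<close>.\<close>
  have E_deriv: "((\<lambda>t. integral {0..t} eta) has_real_derivative eta t) (at t)" if "0 < t" "t < 2" for t
  proof -
    have "((\<lambda>t. integral {0..t} eta) has_real_derivative eta t) (at t within {0..2})"
      using that by (intro integral_has_real_derivative continuous_on_eta) auto
    then show ?thesis using that at_within_Icc_at[of 0 t 2] by simp
  qed
  have contH: "continuous_on {0..1/2} H"
  proof -
    have cu: "continuous_on {0..1/2} u" unfolding u_def
      by (intro continuous_on_mult continuous_on_const continuous_on_powr' continuous_on_id continuous_on_diff) auto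
    have "continuous_on {0..1} (\<lambda>t. integral {0..t} eta)"
      by (intro indefinite_integral_continuous_1 integrable_continuous_real continuous_on_eta)
    then have "continuous_on {0..1/2} (\<lambda>p. integral {0..u p} eta)"
      using cu by (rule continuous_on_compose2) (use u1 in auto)
    moreover have "continuous_on {0..1/2} uv" unfolding uv_def
      by (intro continuous_on_mult continuous_on_const continuous_on_powr' continuous_on_id continuous_on_diff) auto
    ultimately show ?thesis unfolding H_def \<Phi>_def
      using cu by (intro continuous_intros) auto
  qed
  have derH: "(H has_real_derivative c\<^sup>2 * f p) (at p)" if p: "p \<in> {0<..<1/2}" for p
  proof -
    define P Q where "P = p powr (1/3)" and "Q = (1 - p) powr (1/3)"
    have PQ: "P > 0" "Q > 0" "P ^ 3 = p" "Q ^ 3 = 1 - p"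
      using p by (simp_all add: P_def Q_def powr_power)
    have pw: "p powr (2/3) = P\<^sup>2" "p powr (-1/3) = 1 / P" "p powr (-2/3) = 1 / P\<^sup>2"
      "(1 - p) powr (2/3) = Q\<^sup>2" "(1 - p) powr (-1/3) = 1 / Q" "(1 - p) powr (-2/3) = 1 / Q\<^sup>2"
      "(1 - p) powr (-4/3) = 1 / Q ^ 4"
      using p by (simp_all add: P_def Q_def powr_power powr_minus_divide)
    define v where "v = c * Q\<^sup>2 / P"
    have up: "u p = c * P\<^sup>2 / Q" using pw by (simp add: u_def)
    have pos: "u p > 0" "v > 0" using PQ c by (simp_all add: up v_def)
    have u2: "u p < 2" using u1[of p] p by auto
    have "u p + v = c * (P ^ 3 + Q ^ 3) / (P * Q)"
      using PQ(1,2) by (simp add: up v_def field_simps eval_nat_numeral)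
    then have s: "u p + v = c / (P * Q)" using PQ by simp
    have "u p * v * (u p + v) = c ^ 3"
      unfolding s using PQ(1,2) by (simp add: up v_def field_simps eval_nat_numeral)
    then have uvs: "u p * v * (u p + v) = 2" using c by simp
    have "sqrt (2 / u p + (u p)\<^sup>2 / 4) = v + u p / 2"
    proof (rule real_sqrt_unique)
      have "2 / u p = v * (u p + v)" using uvs pos by (simp add: field_simps)
      then show "(v + u p / 2)\<^sup>2 = 2 / u p + (u p)\<^sup>2 / 4"
        by (simp add: power2_eq_square field_simps)
    qed (use pos in auto)
    then have k: "sqrt (2 / u p) + eta (u p) - u p / 2 = v"
      using eta_eq[OF pos(1)] by simp
    define u' where "u' = c * (2 / (3 * P * Q) + P\<^sup>2 / (3 * Q ^ 4))"
    have du: "(u has_real_derivative u') (at p)"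
      unfolding u_def u'_def using p pw
      by (auto intro!: derivative_eq_intros simp: field_simps)
    have duv: "(uv has_real_derivative c\<^sup>2 / 3 * (Q / P\<^sup>2 - P / Q\<^sup>2)) (at p)"
      unfolding uv_def using p pw
      by (auto intro!: derivative_eq_intros simp: field_simps P_def[symmetric] Q_def[symmetric])
    have "(\<Phi> has_real_derivative sqrt 2 / sqrt (u p) + eta (u p) - u p / 2) (at (u p))"
      unfolding \<Phi>_def using pos u2
      by (auto intro!: derivative_eq_intros E_deriv simp: field_simps)
    also have "sqrt 2 / sqrt (u p) + eta (u p) - u p / 2 = v"
      using k by (simp add: real_sqrt_divide)
    finally have "((\<lambda>p. \<Phi> (u p)) has_real_derivative v * u') (at p)"
      using du by (rule DERIV_chain2)
    then have "(H has_real_derivative 2 * (v * u') - c\<^sup>2 / 3 * (Q / P\<^sup>2 - P / Q\<^sup>2)) (at p)"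
      unfolding H_def by (intro DERIV_diff DERIV_cmult duv)
    also have "2 * (v * u') - c\<^sup>2 / 3 * (Q / P\<^sup>2 - P / Q\<^sup>2) = c\<^sup>2 * ((P ^ 3 + Q ^ 3) / (P\<^sup>2 * Q\<^sup>2))"
      unfolding v_def u'_def using PQ(1,2) by (simp add: field_simps eval_nat_numeral)
    also have "\<dots> = c\<^sup>2 * f p"
      using PQ pw by (simp add: f_def)
    finally show ?thesis .
  qed
  have "((\<lambda>p. c\<^sup>2 * f p) has_integral (H (1/2) - H 0)) {0..1/2}"
    using contH derH
    by (intro fundamental_theorem_of_calculus_interior)
       (auto simp: has_real_derivative_iff_has_vector_derivative)
  \<comment> \<open>The integrand is symmetric under \<open>p\<close> to \<open>1 - p\<close>, so
    the reflected \<open>- H (1 - p)\<close> is an antiderivative on the other half.\<close>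
  moreover have "((\<lambda>p. c\<^sup>2 * f p) has_integral (- H (1 - 1) - - H (1 - 1/2))) {1/2..1}"
  proof (intro fundamental_theorem_of_calculus_interior)
    show "continuous_on {1/2..1} (\<lambda>p. - H (1 - p))"
      by (intro continuous_intros continuous_on_compose2[OF contH]) auto
    fix p :: real assume p: "p \<in> {1/2<..<1}"
    have "(H has_real_derivative c\<^sup>2 * f (1 - p)) (at (1 - p))" using p by (intro derH) auto
    then have "((\<lambda>p. - H (1 - p)) has_real_derivative - (c\<^sup>2 * f (1 - p) * (0 - 1))) (at p)"
      by (intro DERIV_minus DERIV_chain2[where f = H and g = "\<lambda>p. 1 - p"] DERIV_diff DERIV_const DERIV_ident)
    then show "((\<lambda>p. - H (1 - p)) has_vector_derivative c\<^sup>2 * f p) (at p)"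
      by (simp add: f_def mult.commute has_real_derivative_iff_has_vector_derivative)
  qed auto
  ultimately have "((\<lambda>p. c\<^sup>2 * f p) has_integral (H (1/2) - H 0) + (- H (1 - 1) - - H (1 - 1/2))) {0..1}"
    by (rule has_integral_combine[rotated 2]) auto
  moreover have "((\<lambda>p. c\<^sup>2 * f p) has_integral c\<^sup>2 * Beta (1/3) (1/3)) {0..1}"
    using has_integral_Beta_real[of "1/3" "1/3"] unfolding f_def by (intro has_integral_mult_right) simp
  ultimately have "(H (1/2) - H 0) + (- H (1 - 1) - - H (1 - 1/2)) = c\<^sup>2 * Beta (1/3) (1/3)"
    by (rule has_integral_unique)
  then have "2 * (H (1/2) - H 0) = c\<^sup>2 * Beta (1/3) (1/3)" by simp
  moreover have half: "(1/2) powr t = 2 powr (-t)" for t :: real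
    by (simp add: powr_divide powr_minus_divide)
  \<comment> \<open>At the midpoint \<open>u\<close> and \<open>uv\<close> both equal 1, so
    \<open>H (1/2) = 2 * \<Phi> 1 - 1\<close>; its rational part is
    \<open>-1/2 - 1 = -3/2\<close>.\<close>
  have "u (1/2) = 2 powr (1/3 + (-2/3 + 1/3))"
    unfolding u_def c_def powr_add using half[of "2/3"] half[of "-1/3"] by simp
  then have "u (1/2) = 1" by simp
  moreover have "uv (1/2) = 2 powr (2/3 + (-1/3 + -1/3))"
    unfolding uv_def c(3) powr_add using half[of "1/3"] by simp
  then have "uv (1/2) = 1" by simp
  moreover have "H 0 = 0" by (simp add: H_def u_def uv_def \<Phi>_def)
  ultimately show ?thesis
    by (simp add: H_def \<Phi>_def Beta_third c(3))
qed

subsection \<open>Counting lattice points\<close>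

definition dim_pairs :: "real \<Rightarrow> (nat \<times> nat) set" where
  "dim_pairs x = {(j, k). j \<ge> 1 \<and> k \<ge> 1 \<and> real (j * k * (j + k)) \<le> 2 * x}"

lemma finite_dim_pairs: "finite (dim_pairs x)"
proof (rule finite_subset)
  show "dim_pairs x \<subseteq> {..nat \<lfloor>2 * x\<rfloor>} \<times> {..nat \<lfloor>2 * x\<rfloor>}"
  proof (clarsimp simp: dim_pairs_def simp del: of_nat_mult of_nat_add)
    fix j k :: nat assume jk: "Suc 0 \<le> j" "Suc 0 \<le> k" "real (j * k * (j + k)) \<le> 2 * x"
    have "j * 1 \<le> j * (k * (j + k))" "k * 1 \<le> k * (j * (j + k))"
      using jk by (intro mult_le_mono; simp)+
    then have "j \<le> j * k * (j + k)" "k \<le> j * k * (j + k)" by (simp_all add: ac_simps)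
    then have "real j \<le> 2 * x" "real k \<le> 2 * x"
      using jk(3) by (meson of_nat_le_iff order_trans)+
    then show "j \<le> nat \<lfloor>2 * x\<rfloor> \<and> k \<le> nat \<lfloor>2 * x\<rfloor>" by linarith
  qed
qed auto

text \<open>The pairs are grouped by the value \<open>j * k * (j + k) div 2\<close>; the division is
  exact because \<open>j * k * (j + k)\<close> is always even.\<close>

lemma sum_rho_eq_card_dim_pairs:
  "(\<Sum>n | 1 \<le> n \<and> real n \<le> x. rho n) = card (dim_pairs x)"
proof -
  define f where "f = (\<lambda>(j, k). j * k * (j + k) div 2 :: nat)"
  define I where "I = {n. 1 \<le> n \<and> real n \<le> x}"
  have fin: "finite I"
    by (rule finite_subset[of _ "{..nat \<lfloor>x\<rfloor>}"]) (auto simp: I_def le_nat_floor)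
  have even: "2 * f (j, k) = j * k * (j + k)" for j k
    unfolding f_def prod.case by (rule dvd_mult_div_cancel) auto
  have real_f: "real (j * k * (j + k)) = 2 * real (f (j, k))" for j k
    unfolding even [symmetric] by simp
  have fib: "rho n = card {p \<in> dim_pairs x. f p = n}" if "n \<in> I" for n
  proof -
    have "{(j, k). j \<ge> 1 \<and> k \<ge> 1 \<and> real (j * k * (j + k)) / 2 = real n} = {p \<in> dim_pairs x. f p = n}"
      using that by (auto simp: dim_pairs_def I_def real_f simp del: of_nat_mult of_nat_add)
    then show ?thesis by (simp add: rho_def)
  qed
  have "f ` dim_pairs x \<subseteq> I"
  proof (clarsimp simp: dim_pairs_def I_def real_f simp del: of_nat_mult of_nat_add)
    fix j k :: nat assume "Suc 0 \<le> j" "Suc 0 \<le> k"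
    then have "j * k * (j + k) > 0" by simp
    then show "Suc 0 \<le> f (j, k)" unfolding even [symmetric] by simp
  qed
  then have "card (dim_pairs x) = (\<Sum>n\<in>I. card {p \<in> dim_pairs x. f p = n})"
    using sum.group[OF finite_dim_pairs fin, of f x "\<lambda>_. 1::nat"] by simp
  also have "\<dots> = (\<Sum>n\<in>I. rho n)" using fib by simp
  finally show ?thesis by (simp add: I_def)
qed

text \<open>Completing the square in \<open>k\<close> turns the condition into
  \<open>(k + j / 2)^2 \<le> 2 * x / j + j^2 / 4\<close>.\<close>

lemma dim_pairs_iff:
  assumes "j \<ge> 1"
  shows "(j, k) \<in> dim_pairs x \<longleftrightarrow> k \<ge> 1 \<and> real k \<le> sqrt (2 * x / j + (real j)\<^sup>2 / 4) - real j / 2"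
proof -
  have "real (j * k * (j + k)) \<le> 2 * x \<longleftrightarrow> real k * (real j + real k) \<le> 2 * x / j"
    using assms by (simp add: field_simps)
  also have "\<dots> \<longleftrightarrow> (real k + real j / 2)\<^sup>2 \<le> 2 * x / j + (real j)\<^sup>2 / 4"
    by (simp add: power2_eq_square algebra_simps)
  also have "\<dots> \<longleftrightarrow> real k + real j / 2 \<le> sqrt (2 * x / j + (real j)\<^sup>2 / 4)"
    using real_le_rsqrt[of "real k + real j / 2"] sqrt_ge_absD[of "real k + real j / 2"] by auto
  finally show ?thesis using assms by (auto simp: dim_pairs_def)
qed

text \<open>If both coordinates exceed \<open>a\<close>, then
  \<open>j * k * (j + k) > 2 * a ^ 3\<close>, so every pair has a coordinate at most
  \<open>a\<close>. The two cases are mirror images, and their overlap is the full square of side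
  \<open>M\<close>.\<close>

lemma card_dim_pairs_hyperbola:
  assumes a: "a \<ge> 0" and x: "x = a ^ 3"
  shows "real (card (dim_pairs x)) =
    2 * (\<Sum>j=1..nat \<lfloor>a\<rfloor>. of_int \<lfloor>sqrt (2 * x / real j + (real j)\<^sup>2 / 4) - real j / 2\<rfloor>)
    - (real (nat \<lfloor>a\<rfloor>))\<^sup>2"
proof -
  define M where "M = nat \<lfloor>a\<rfloor>"
  have M: "real M \<le> a" "a < real M + 1" using a unfolding M_def by linarith+
  define K where "K j = sqrt (2 * x / real j + (real j)\<^sup>2 / 4) - real j / 2" for j
  have x0: "x \<ge> 0" using a x by simp
  \<comment> \<open>Nonnegativity ensures that \<open>nat\<close> does not alter the floor when
    points are counted.\<close>
  have K0: "K j \<ge> 0" for j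
  proof -
    have "real j / 2 \<le> sqrt (2 * x / real j + (real j)\<^sup>2 / 4)"
      using x0 by (intro real_le_rsqrt) (simp add: power_divide)
    then show ?thesis by (simp add: K_def)
  qed
  define A where "A = (SIGMA j:{1..M}. {1..nat \<lfloor>K j\<rfloor>})"
  define B where "B = prod.swap ` A"
  have memA: "(j, k) \<in> A \<longleftrightarrow> j \<le> M \<and> (j, k) \<in> dim_pairs x" for j k
  proof (cases "j \<ge> 1")
    case True
    then show ?thesis using dim_pairs_iff[OF True, of k x] K0[of j]
      by (auto simp: A_def K_def [symmetric] le_nat_floor le_nat_iff le_floor_iff)
  qed (auto simp: A_def dim_pairs_def)
  have swap: "(j, k) \<in> dim_pairs x \<longleftrightarrow> (k, j) \<in> dim_pairs x" for j k
    by (auto simp: dim_pairs_def ac_simps)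
  have memB: "(j, k) \<in> B \<longleftrightarrow> k \<le> M \<and> (j, k) \<in> dim_pairs x" for j k
  proof -
    have "(j, k) \<in> B \<longleftrightarrow> (k, j) \<in> A" by (force simp: B_def)
    then show ?thesis using memA swap by simp
  qed
  have "dim_pairs x = A \<union> B"
  proof (intro equalityI subrelI)
    fix j k assume jk: "(j, k) \<in> dim_pairs x"
    have "j \<le> M \<or> k \<le> M"
    proof (rule ccontr)
      assume "\<not> ?thesis"
      then have "real j > a" "real k > a" using M by linarith+
      then have "real j * real k * (real j + real k) > a * a * (a + a)"
        using a by (intro mult_strict_mono) auto
      moreover have "a * a * (a + a) = 2 * x" by (simp add: x eval_nat_numeral)
      ultimately show False using jk by (simp add: dim_pairs_def)
    qed
    then show "(j, k) \<in> A \<union> B" using jk memA memB by blast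
  qed (use memA memB in blast)
  moreover have "A \<inter> B = {1..M} \<times> {1..M}"
  proof (intro equalityI subrelI)
    fix j k assume "(j, k) \<in> {1..M} \<times> {1..M}"
    then have jk: "1 \<le> j" "1 \<le> k" "real j \<le> a" "real k \<le> a" "j \<le> M" "k \<le> M" using M by auto
    then have "real j * real k * (real j + real k) \<le> a * a * (a + a)"
      using a by (intro mult_mono add_mono) auto
    also have "\<dots> = 2 * x" by (simp add: x eval_nat_numeral)
    finally have "(j, k) \<in> dim_pairs x" using jk by (simp add: dim_pairs_def)
    then show "(j, k) \<in> A \<inter> B" using jk memA memB by blast
  qed (auto simp: memA memB dim_pairs_def)
  moreover have "finite A" "finite B" by (simp_all add: A_def B_def)
  moreover have "card B = card A" unfolding B_def by (rule card_image) (auto intro: inj_onI)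
  moreover have "real (card A) = (\<Sum>j=1..M. of_int \<lfloor>K j\<rfloor>)"
    using K0 by (simp add: A_def)
  moreover have "2 * card A = card (dim_pairs x) + M * M"
    using card_Un_Int[of A B] calculation by simp
  then have "2 * real (card A) = real (card (dim_pairs x)) + real M * real M"
    by (simp flip: of_nat_mult of_nat_add)
  ultimately show ?thesis by (simp add: M_def K_def power2_eq_square)
qed

section \<open>The asymptotic estimate\<close>

text \<open>Each piece of the hyperbola formula is replaced by its main term at cost
  \<open>O(a)\<close>. The coefficient -3/2 combines -1/2 from twice the sum of
  \<open>- j / 2\<close> with -1 from the overlap square.\<close>

lemma card_dim_pairs_estimate:
  assumes z: "\<And>N. \<bar>(\<Sum>n=1..N. 1 / sqrt (real n)) - 2 * sqrt (Suc N) - z\<bar> \<le> 1 / sqrt (Suc N)"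
    and a: "a \<ge> 1" and x: "x = a ^ 3"
  shows "\<bar>real (card (dim_pairs x))
            - ((4 * sqrt 2 + 2 * integral {0..1} eta - 3 / 2) * a\<^sup>2 + 2 * sqrt (2 * x) * z)\<bar>
          \<le> (15 + 2 * eta 1) * a"
proof -
  define M where "M = nat \<lfloor>a\<rfloor>"
  have M: "real M \<le> a" "a < real M + 1" using a unfolding M_def by linarith+
  have x0: "x > 0" using a x by simp
  define K where "K j = sqrt (2 * x / real j + (real j)\<^sup>2 / 4) - real j / 2" for j
  \<comment> \<open>As \<open>x = a ^ 3\<close>, the substitution \<open>j = a * s\<close> scales
    the difference of square roots by \<open>a\<close>.\<close>
  have K: "K j = sqrt (2 * x) * (1 / sqrt (real j)) + a * eta (real j / a) - real j / 2"
    if "j \<in> {1..M}" for j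
  proof -
    have j: "real j > 0" using that by simp
    have "a * sqrt t = sqrt (a\<^sup>2 * t)" for t using a by (simp add: real_sqrt_mult)
    then have "a * eta (real j / a)
        = sqrt (a\<^sup>2 * (2 / (j / a) + (j / a)\<^sup>2 / 4)) - sqrt (a\<^sup>2 * (2 / (j / a)))"
      using a j by (simp add: eta_eq right_diff_distrib)
    also have "a\<^sup>2 * (2 / (j / a) + (j / a)\<^sup>2 / 4) = 2 * x / j + (real j)\<^sup>2 / 4"
      using a j unfolding x by (simp add: field_simps eval_nat_numeral)
    also have "a\<^sup>2 * (2 / (j / a)) = 2 * x / j"
      using a j unfolding x by (simp add: field_simps eval_nat_numeral)
    also have "sqrt (2 * x / j) = sqrt (2 * x) * (1 / sqrt (real j))"
      by (simp add: real_sqrt_divide)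
    finally show ?thesis by (simp add: K_def)
  qed
  define S where "S = (\<Sum>j=1..M. 1 / sqrt (real j))"
  define T where "T = (\<Sum>j=1..M. eta (real j / a))"
  have gauss: "(\<Sum>j=1..M. real j / 2) = real M * (real M + 1) / 4"
    by (induction M) (auto simp: field_simps)
  have sumK: "(\<Sum>j=1..M. K j) = sqrt (2 * x) * S + a * T - real M * (real M + 1) / 4"
  proof -
    have "(\<Sum>j=1..M. K j)
        = (\<Sum>j=1..M. sqrt (2 * x) * (1 / sqrt (real j)) + a * eta (real j / a) - real j / 2)"
      using K by (rule sum.cong[OF refl])
    then show ?thesis
      unfolding S_def T_def sum_distrib_left gauss [symmetric] by (simp only: sum.distrib sum_subtractf)
  qed
  have floor: "\<bar>(\<Sum>j=1..M. K j) - (\<Sum>j=1..M. of_int \<lfloor>K j\<rfloor>)\<bar> \<le> a"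
  proof -
    have "\<bar>(\<Sum>j=1..M. K j) - (\<Sum>j=1..M. of_int \<lfloor>K j\<rfloor>)\<bar> = \<bar>\<Sum>j=1..M. K j - of_int \<lfloor>K j\<rfloor>\<bar>"
      by (simp add: sum_subtractf)
    also have "\<dots> \<le> (\<Sum>j=1..M. 1)"
      by (intro order_trans[OF sum_abs] sum_mono) linarith
    finally show ?thesis using M by simp
  qed
  \<comment> \<open>This factor has order \<open>a * sqrt a\<close>, so an error of order
    \<open>1 / sqrt a\<close> in \<open>S\<close> contributes \<open>O(a)\<close>.\<close>
  have sq: "sqrt (2 * x) = sqrt 2 * (a * sqrt a)"
    using a by (simp add: x real_sqrt_mult eval_nat_numeral)
  have S: "\<bar>sqrt (2 * x) * S - (2 * sqrt 2 * a\<^sup>2 + sqrt (2 * x) * z)\<bar> \<le> 4 * a"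
  proof -
    have "sqrt (Suc M) \<ge> sqrt a" using M by simp
    have s0: "sqrt a > 0" using a by simp
    have i: "1 / sqrt (Suc M) \<le> 1 / sqrt a"
      using a s0 \<open>sqrt (Suc M) \<ge> sqrt a\<close> by (intro divide_left_mono mult_pos_pos) auto
    have d: "sqrt (Suc M) - sqrt a \<le> (1 / sqrt a) / 2"
    proof -
      have "(sqrt (Suc M) - sqrt a) * (2 * sqrt a) \<le> (sqrt (Suc M) - sqrt a) * (sqrt (Suc M) + sqrt a)"
        using \<open>sqrt (Suc M) \<ge> sqrt a\<close> by (intro mult_left_mono) auto
      also have "\<dots> = real (Suc M) - a" using a by (simp add: algebra_simps)
      also have "\<dots> \<le> 1" using M by simp
      finally show ?thesis using s0 by (simp add: field_simps)
    qed
    \<comment> \<open>Replacing \<open>2 * t\<close> by \<open>2 * r\<close> costs at most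
      \<open>q\<close>, and the error \<open>w\<close> at most another \<open>q\<close>.\<close>
    have bound: "\<bar>S - (2 * r + z)\<bar> \<le> 2 * q"
      if "t - r \<le> q / 2" "0 < q" "\<bar>S - 2 * t - z\<bar> \<le> w" "w \<le> q" "r \<le> t" for r q t w :: real
      using that by linarith
    have "\<bar>S - (2 * sqrt a + z)\<bar> \<le> 2 * (1 / sqrt a)"
      using s0 by (intro bound[OF d _ z[of M, folded S_def] i \<open>sqrt (Suc M) \<ge> sqrt a\<close>]) simp
    then have "sqrt (2 * x) * \<bar>S - (2 * sqrt a + z)\<bar> \<le> sqrt (2 * x) * (2 * (1 / sqrt a))"
      using x0 by (intro mult_left_mono) auto
    also have "\<dots> = sqrt 2 * 2 * a" using s0 by (simp add: sq)
    also have "\<dots> \<le> 2 * 2 * a" using a sqrt2_less_2 by (intro mult_right_mono) auto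
    also have "sqrt (2 * x) * \<bar>S - (2 * sqrt a + z)\<bar> = \<bar>sqrt (2 * x) * (S - (2 * sqrt a + z))\<bar>"
      using x0 by (simp add: abs_mult)
    also have "sqrt (2 * x) * (S - (2 * sqrt a + z))
        = sqrt (2 * x) * S - (sqrt (2 * x) * (2 * sqrt a) + sqrt (2 * x) * z)"
      by (simp add: algebra_simps)
    also have "sqrt (2 * x) * (2 * sqrt a) = 2 * sqrt 2 * a\<^sup>2"
      using a by (simp add: sq power2_eq_square)
    finally show ?thesis by simp
  qed
  have T: "\<bar>a * T - a\<^sup>2 * integral {0..1} eta\<bar> \<le> a * eta 1"
  proof -
    have "\<bar>T - a * integral {0..1} eta\<bar> \<le> eta 1"
      unfolding T_def M_def using a
      by (intro riemann_sum_mono_error eta_mono continuous_on_eta) (auto simp: eta_nonneg)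
    then have "a * \<bar>T - a * integral {0..1} eta\<bar> \<le> a * eta 1" using a by (intro mult_left_mono) auto
    also have "a * \<bar>T - a * integral {0..1} eta\<bar> = \<bar>a * (T - a * integral {0..1} eta)\<bar>"
      using a by (simp add: abs_mult)
    finally show ?thesis by (simp add: algebra_simps power2_eq_square)
  qed
  have sqM: "\<bar>(real M)\<^sup>2 - a\<^sup>2\<bar> \<le> 2 * a"
  proof -
    have "(a - real M) * (a + real M) \<le> 1 * (2 * a)" using M a by (intro mult_mono) auto
    moreover have "(a - real M) * (a + real M) \<ge> 0" using M a by (intro mult_nonneg_nonneg) auto
    ultimately show ?thesis by (simp add: algebra_simps power2_eq_square abs_le_iff)
  qed
  \<comment> \<open>The multiples of \<open>a\<close> are 2 from the floors, 8 from
    \<open>p\<close>, 3 from \<open>m\<close> and 1/2 from \<open>r\<close>, which is below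
    15.\<close>
  have bound: "\<bar>2 * F - m - (2 * P + 2 * Q - 3 / 2 * b)\<bar> \<le> 15 * a + 2 * e"
    if "\<bar>k - F\<bar> \<le> a" "\<bar>p - P\<bar> \<le> 4 * a" "\<bar>q - Q\<bar> \<le> e" "\<bar>m - b\<bar> \<le> 2 * a"
      "k = p + q - (m / 4 + r / 4)" "0 \<le> r" "r \<le> a" for F P Q b e k p q m r :: real
    using that by linarith
  have "real M * (real M + 1) / 4 = (real M)\<^sup>2 / 4 + real M / 4"
    by (simp add: field_simps power2_eq_square)
  then have "\<bar>2 * (\<Sum>j=1..M. of_int \<lfloor>K j\<rfloor>) - (real M)\<^sup>2
      - (2 * (2 * sqrt 2 * a\<^sup>2 + sqrt (2 * x) * z) + 2 * (a\<^sup>2 * integral {0..1} eta) - 3 / 2 * a\<^sup>2)\<bar>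
      \<le> 15 * a + 2 * (a * eta 1)"
    using sumK M by (intro bound[OF floor S T sqM, of "real M"]) (simp_all add: add_divide_distrib)
  moreover have "real (card (dim_pairs x)) = 2 * (\<Sum>j=1..M. of_int \<lfloor>K j\<rfloor>) - (real M)\<^sup>2"
    unfolding M_def K_def using a x by (intro card_dim_pairs_hyperbola) auto
  ultimately show ?thesis by (simp add: algebra_simps)
qed

theorem theorem1p2:
  "(\<lambda>x :: real.
      of_nat (\<Sum>n | 1 \<le> n \<and> real n \<le> x. rho n)
      - (complex_of_real (2 powr (2/3) * sqrt 3 * Gamma (1/3) ^ 3 / (4 * pi) * x powr (2/3))
         + complex_of_real (2 powr (3/2)) * zeta (1/2) * complex_of_real (sqrt x)))
   \<in> O[at_top](\<lambda>x. complex_of_real (x powr (1/3)))"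
proof -
  obtain z where zeta: "zeta (1/2) = complex_of_real z"
    and z: "\<And>N. \<bar>(\<Sum>n=1..N. 1 / sqrt (real n)) - 2 * sqrt (Suc N) - z\<bar> \<le> 1 / sqrt (Suc N)"
    by (rule sum_inverse_sqrt_bounds) blast
  show ?thesis
  \<comment> \<open>The estimate is uniform from \<open>x = 1\<close> on, where
    \<open>a = x powr (1/3)\<close> is at least 1.\<close>
  proof (rule bigoI[of _ "15 + 2 * eta 1"], rule eventually_mono[OF eventually_ge_at_top[of 1]])
    fix x :: real assume x: "x \<ge> 1"
    define a where "a = x powr (1/3)"
    have a: "a \<ge> 1" "x = a ^ 3" "x powr (2/3) = a\<^sup>2"
      using x by (simp_all add: a_def powr_power ge_one_powr_ge_zero)
    have "2 powr (3/2) * sqrt x = 2 * sqrt (2 * x)"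
    proof -
      have "2 powr (3/2 :: real) = 2 powr (1 + 1/2)" by simp
      also have "\<dots> = 2 * sqrt 2" by (subst powr_add) (simp add: powr_half_sqrt)
      finally show ?thesis by (simp add: real_sqrt_mult)
    qed
    then have "of_nat (\<Sum>n | 1 \<le> n \<and> real n \<le> x. rho n)
      - (complex_of_real (2 powr (2/3) * sqrt 3 * Gamma (1/3) ^ 3 / (4 * pi) * x powr (2/3))
         + complex_of_real (2 powr (3/2)) * zeta (1/2) * complex_of_real (sqrt x))
      = complex_of_real (real (card (dim_pairs x))
            - ((4 * sqrt 2 + 2 * integral {0..1} eta - 3 / 2) * a\<^sup>2 + 2 * sqrt (2 * x) * z))"
      unfolding sum_rho_eq_card_dim_pairs area_constant zeta a(3)
      by (simp add: ac_simps flip: of_real_mult)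
    then show "norm (of_nat (\<Sum>n | 1 \<le> n \<and> real n \<le> x. rho n)
      - (complex_of_real (2 powr (2/3) * sqrt 3 * Gamma (1/3) ^ 3 / (4 * pi) * x powr (2/3))
         + complex_of_real (2 powr (3/2)) * zeta (1/2) * complex_of_real (sqrt x)))
      \<le> (15 + 2 * eta 1) * norm (complex_of_real (x powr (1/3)))"
      using card_dim_pairs_estimate[OF z a(1,2)] a(1)
      by (simp only: norm_of_real a_def [symmetric])
  qed
qed

end
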